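(* Let $\mathcal{A}$ be an $n\times n$ proper (lower) Hessenberg sign pattern whose digraph $D(\mathcal{A})$ has at least one $k$-cycle for each $k$ with $2\le k\le n$. Then $\mathcal{A}$ requires the nSMP.
   Context: A real $n\times n$ matrix $A$ has the non-symmetric strong multiplicity property (nSMP) if the only real $n\times n$ matrix $X$ satisfying all of (1) $A\circ X=O$ (entrywise product), (2) $AX^T-X^TA=O$, and (3) $\mathrm{tr}(X^TA^k)=0$ for all $0\le k<n$, is $X=O$ (the zero matrix). A sign pattern is an $n\times n$ matrix $\mathcal{A}$ with entries in $\{+,-,0\}$; $Q(\mathcal{A})$ is the set of real $n\times n$ matrices $A$ with $A_{ij}>0$ if $\mathcal{A}_{ij}=+$, $A_{ij}<0$ if $\mathcal{A}_{ij}=-$, and $A_{ij}=0$ if $\mathcal{A}_{ij}=0$. The pattern $\mathcal{A}$ requires a property if every $A\in Q(\mathcal{A})$ has the property. A proper (lower) Hessenberg pattern is an $n\times n$ pattern $\mathcal{A}$ such that $\mathcal{A}_{i,i+1}\neq 0$ for $1\le i<n$ and $\mathcal{A}_{i,j}=0$ for all $j\ge i+2$. The digraph $D(\mathcal{A})$ has vertices $v_1,\dots,v_n$ and an arc from $v_i$ to $v_j$ if and only if $\mathcal{A}_{ij}\ne 0$. A (simple, directed) $k$-cycle consists of $k$ distinct vertices $u_1,\dots,u_k$ and the arcs $(u_1,u_2),\dots,(u_{k-1},u_k),(u_k,u_1)$. *)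

theory Defs
  imports
    Jordan_Normal_Form.Matrix
    Graph_Theory.Pair_Digraph
begin

text \<open>
  Matrices are those of \<^theory>\<open>Jordan_Normal_Form.Matrix\<close>, so all indices run over
  \<open>{0..<n}\<close>: index \<open>i\<close> here is index \<open>i + 1\<close> in the usual notation.
\<close>

definition hadamard_mat :: "'a :: times mat \<Rightarrow> 'a mat \<Rightarrow> 'a mat" (infixl \<open>\<circ>\<^sub>m\<close> 70) where
  "A \<circ>\<^sub>m B = mat (dim_row A) (dim_col A) (\<lambda>(i, j). A $$ (i, j) * B $$ (i, j))"

definition trace_mat :: "'a :: comm_monoid_add mat \<Rightarrow> 'a" where
  "trace_mat A = (\<Sum>i<dim_row A. A $$ (i, i))"

definition has_nSMP :: "nat \<Rightarrow> real mat \<Rightarrow> bool" where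
  "has_nSMP n A \<longleftrightarrow>
     A \<in> carrier_mat n n \<and>
     (\<forall>X \<in> carrier_mat n n.
        A \<circ>\<^sub>m X = 0\<^sub>m n n \<and>
        A * transpose_mat X - transpose_mat X * A = 0\<^sub>m n n \<and>
        (\<forall>k<n. trace_mat (transpose_mat X * A ^\<^sub>m k) = 0)
        \<longrightarrow> X = 0\<^sub>m n n)"

datatype sign = Plus | Minus | Zero

fun has_sign :: "real \<Rightarrow> sign \<Rightarrow> bool" where
  "has_sign x Plus \<longleftrightarrow> x > 0"
| "has_sign x Minus \<longleftrightarrow> x < 0"
| "has_sign x Zero \<longleftrightarrow> x = 0"

text \<open>An \<open>n \<times> n\<close> sign pattern is an element of \<open>carrier_mat n n\<close> over \<^typ>\<open>sign\<close>.\<close>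

definition qualitative_class :: "sign mat \<Rightarrow> real mat set" where
  "qualitative_class S =
     {A \<in> carrier_mat (dim_row S) (dim_col S).
        \<forall>i < dim_row S. \<forall>j < dim_col S. has_sign (A $$ (i, j)) (S $$ (i, j))}"

definition requires :: "sign mat \<Rightarrow> (real mat \<Rightarrow> bool) \<Rightarrow> bool" where
  "requires S P \<longleftrightarrow> (\<forall>A \<in> qualitative_class S. P A)"

definition proper_hessenberg_pattern :: "nat \<Rightarrow> sign mat \<Rightarrow> bool" where
  "proper_hessenberg_pattern n S \<longleftrightarrow>
     S \<in> carrier_mat n n \<and>
     (\<forall>i. i + 1 < n \<longrightarrow> S $$ (i, i + 1) \<noteq> Zero) \<and>
     (\<forall>i j. j < n \<and> i + 2 \<le> j \<longrightarrow> S $$ (i, j) = Zero)"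

definition pattern_digraph :: "nat \<Rightarrow> sign mat \<Rightarrow> nat pair_pre_digraph" where
  "pattern_digraph n S =
     \<lparr> pverts = {0..<n}, parcs = {(i, j). i < n \<and> j < n \<and> S $$ (i, j) \<noteq> Zero} \<rparr>"

text \<open>
  \<^const>\<open>pre_digraph.cycle\<close> takes the list of arcs of a closed walk with pairwise distinct
  vertices, so the length of the list is the number of vertices on the cycle; loops count as
  cycles of length 1.
\<close>

definition has_k_cycle :: "'a pair_pre_digraph \<Rightarrow> nat \<Rightarrow> bool" where
  "has_k_cycle G k \<longleftrightarrow> (\<exists>p. pre_digraph.cycle (with_proj G) p \<and> length p = k)"

end

theory Submission
  imports Defs
begin

text \<open>
  Put \<open>Y = X\<^sup>T\<close>, which commutes with \<open>A\<close>. As \<open>A\<close> is proper Hessenberg, a cycle of length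
  \<open>d + 1 \<ge> 2\<close> must climb \<open>i \<rightarrow> i + 1 \<rightarrow> \<dots> \<rightarrow> i + d\<close> and return by one arc, so some
  \<open>A\<^sub>i\<^sub>+\<^sub>d\<^sub>,\<^sub>i \<noteq> 0\<close>, and hence \<open>Y\<^sub>i\<^sub>,\<^sub>i\<^sub>+\<^sub>d = X\<^sub>i\<^sub>+\<^sub>d\<^sub>,\<^sub>i = 0\<close>. If all superdiagonals of \<open>Y\<close> above
  the \<open>d\<close>-th vanish, then comparing entries of \<open>AY = YA\<close> shows that consecutive entries of the
  \<open>d\<close>-th one are nonzero multiples of each other (equal for \<open>d = 0\<close>). So, for \<open>d\<close> decreasing to \<open>1\<close>,
  the whole \<open>d\<close>-th superdiagonal vanishes; then the diagonal is constant, and it is zero because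
  \<open>tr Y = 0\<close>. Finally, \<open>Y\<close> is determined by its first row, which is zero.
\<close>

section \<open>Cycles in Hessenberg digraphs\<close>

text \<open>Induct from the end of the walk: the later heads fill an interval up to
  \<open>M\<close>, and \<open>snd e\<close> lies outside it, is at most \<open>M\<close>, and is at
  least \<open>snd f - 1\<close>. Hence it is exactly \<open>snd f - 1\<close>.\<close>

lemma ascending_walk_heads:
  fixes q :: "(nat \<times> nat) list"
  assumes "pcas u q M" "q \<noteq> []" "distinct (map snd q)"
    and "\<And>b. b \<in> snd ` set q \<Longrightarrow> b \<le> M"
    and "\<And>a b. (a, b) \<in> set q \<Longrightarrow> b \<le> a + 1"
  shows "snd ` set q = {snd (hd q)..M}"
  using assms
proof (induction q arbitrary: u)
  case (Cons e q)
  show ?case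
  proof (cases q)
    case Nil
    with Cons.prems show ?thesis by auto
  next
    case (Cons f r)
    have f: "(snd e, snd f) \<in> set (e # q)"
      using Cons.prems(1) Cons by (cases f) auto
    have "snd ` set q = {snd f..M}"
      using Cons.IH[of "snd e"] Cons.prems Cons by auto
    moreover have "snd e \<notin> snd ` set q" "snd e \<le> M"
      using Cons.prems by auto
    moreover have "snd f \<le> snd e + 1"
      using Cons.prems(5)[OF f] by simp
    ultimately show ?thesis by auto
  qed
qed simp

lemma pcas_append:
  "pcas u (p @ q) v \<longleftrightarrow> (\<exists>w. pcas u p w \<and> pcas w q v)"
  by (induction p arbitrary: u) auto

lemma ascending_cycle_return_arc:
  fixes p :: "(nat \<times> nat) list"
  assumes walk: "pcas u p u" and ne: "p \<noteq> []" and dist: "distinct (map snd p)"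
    and asc: "\<And>a b. (a, b) \<in> set p \<Longrightarrow> b \<le> a + 1"
  shows "\<exists>i. (i + length p - 1, i) \<in> set p"
proof -
  define M where "M = Max (snd ` set p)"
  have "M \<in> snd ` set p"
    unfolding M_def using ne by (intro Max_in) auto
  then obtain e where e: "e \<in> set p" "snd e = M" by auto
  then obtain p1 p2 where p: "p = p1 @ e # p2"
    by (auto simp: in_set_conv_decomp)
  \<comment> \<open>The cycle rotated to start and end at its largest vertex \<open>M\<close>; its
    first arc is then the return arc.\<close>
  define q where "q = p2 @ p1 @ [e]"
  have q: "set q = set p" "length q = length p" "q \<noteq> []" "distinct (map snd q)"
    using dist by (auto simp: p q_def)
  have walk_q: "pcas M q M"
    using walk e(2) by (auto simp: p q_def pcas_append)
  have heads: "snd ` set q = {snd (hd q)..M}"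
    using walk_q q asc by (intro ascending_walk_heads) (auto simp: M_def)
  have "length q = card (snd ` set q)"
    using distinct_card[OF q(4)] by simp
  then have "length q = M + 1 - snd (hd q)" by (simp add: heads)
  moreover have "fst (hd q) = M" "hd q \<in> set q"
    using walk_q q(3) by (cases q; auto)+
  \<comment> \<open>Ensures that the subtraction in the length formula is not truncated.\<close>
  moreover have "snd (hd q) \<le> M"
    using heads \<open>hd q \<in> set q\<close> by fastforce
  ultimately have "hd q = (snd (hd q) + length p - 1, snd (hd q))"
    using q(2) by (simp add: prod_eq_iff)
  with \<open>hd q \<in> set q\<close> q(1) show ?thesis by metis
qed

lemma hessenberg_cycle_entry:
  assumes hess: "proper_hessenberg_pattern n S"
    and cyc: "has_k_cycle (pattern_digraph n S) (d + 1)"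
  obtains i where "i + d < n" "S $$ (i + d, i) \<noteq> Zero"
proof -
  let ?G = "with_proj (pattern_digraph n S)"
  obtain p u where p: "pre_digraph.awalk ?G u p u"
      "distinct (tl (pre_digraph.awalk_verts ?G u p))" "p \<noteq> []" "length p = d + 1"
    using cyc by (auto simp: has_k_cycle_def pre_digraph.cycle_def)
  have cas: "pre_digraph.cas ?G u p u" and arcs: "set p \<subseteq> parcs (pattern_digraph n S)"
    using p(1) by (auto simp: pre_digraph.awalk_def)
  \<comment> \<open>The vertex list is the start \<open>u\<close> followed by the arc heads, so its
    tail is \<open>map snd p\<close>.\<close>
  have "distinct (map snd p)"
    using p(2,3) pre_digraph.awalk_verts_conv'[OF cas] by simp
  moreover have "b \<le> a + 1" if "(a, b) \<in> set p" for a b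
  proof (rule ccontr)
    assume "\<not> b \<le> a + 1"
    then have "a + 2 \<le> b" by simp
    then show False
      using that arcs hess by (auto simp: pattern_digraph_def proper_hessenberg_pattern_def)
  qed
  ultimately obtain i where "(i + length p - 1, i) \<in> set p"
    using ascending_cycle_return_arc[of u p] cas p(3) by (auto simp: cas_with_proj_eq)
  then show thesis
    using arcs p(4) that by (auto simp: pattern_digraph_def)
qed

section \<open>Matrices commuting with a proper Hessenberg matrix\<close>

locale hessenberg_commuting =
  fixes n :: nat and A Y :: "'a :: idom mat"
  assumes A: "A \<in> carrier_mat n n" and Y: "Y \<in> carrier_mat n n"
    and super_nz: "\<And>i. i + 1 < n \<Longrightarrow> A $$ (i, i + 1) \<noteq> 0"
    and hess: "\<And>i j. j < n \<Longrightarrow> i + 2 \<le> j \<Longrightarrow> A $$ (i, j) = 0"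
    and commute: "A * Y = Y * A"
begin

lemma commute_entry:
  assumes "i < n" "j < n"
  shows "(\<Sum>k<n. A $$ (i, k) * Y $$ (k, j)) = (\<Sum>k<n. Y $$ (i, k) * A $$ (k, j))"
proof -
  have "(A * Y) $$ (i, j) = (Y * A) $$ (i, j)" by (simp add: commute)
  then show ?thesis
    using assms A Y by (simp add: scalar_prod_def atLeast0LessThan)
qed

text \<open>Compare the entries at \<open>(i, i + d + 1)\<close> of \<open>A * Y\<close> and
  \<open>Y * A\<close>. The zeros of \<open>A\<close> and \<open>Y\<close> leave only
  \<open>k = i + 1\<close> on the left and \<open>k = i + d\<close> on the right.\<close>

lemma superdiagonal_step:
  assumes above: "\<And>i j. j < n \<Longrightarrow> i + d < j \<Longrightarrow> Y $$ (i, j) = 0"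
    and i: "i + d + 1 < n"
  shows "A $$ (i, i + 1) * Y $$ (i + 1, i + 1 + d)
    = Y $$ (i, i + d) * A $$ (i + d, i + d + 1)"
proof -
  have "(\<Sum>k<n. A $$ (i, k) * Y $$ (k, i + d + 1))
      = (\<Sum>k\<in>{i + 1}. A $$ (i, k) * Y $$ (k, i + d + 1))"
  proof (intro sum.mono_neutral_right ballI)
    fix k assume k: "k \<in> {..<n} - {i + 1}"
    show "A $$ (i, k) * Y $$ (k, i + d + 1) = 0"
      using k i above[of "i + d + 1" k] hess[of k i] by (cases "k \<le> i") auto
  qed (use i in auto)
  moreover have "(\<Sum>k<n. Y $$ (i, k) * A $$ (k, i + d + 1))
      = (\<Sum>k\<in>{i + d}. Y $$ (i, k) * A $$ (k, i + d + 1))"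
  proof (intro sum.mono_neutral_right ballI)
    fix k assume k: "k \<in> {..<n} - {i + d}"
    show "Y $$ (i, k) * A $$ (k, i + d + 1) = 0"
      using k i above[of k i] hess[of "i + d + 1" k] by (cases "k < i + d") auto
  qed (use i in auto)
  ultimately show ?thesis
    using commute_entry[of i "i + d + 1"] i by (simp add: add_ac)
qed

lemma superdiagonal_zero:
  assumes above: "\<And>i j. j < n \<Longrightarrow> i + d < j \<Longrightarrow> Y $$ (i, j) = 0"
    and m: "m + d < n" "Y $$ (m, m + d) = 0"
    and i: "i + d < n"
  shows "Y $$ (i, i + d) = 0"
proof -
  have step: "Y $$ (Suc j, Suc j + d) = 0 \<longleftrightarrow> Y $$ (j, j + d) = 0" if "Suc j + d < n" for j
  proof -
    have "A $$ (j, j + 1) * Y $$ (Suc j, Suc j + d) = Y $$ (j, j + d) * A $$ (j + d, j + d + 1)"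
      using superdiagonal_step[of d j] above that by simp
    moreover have "A $$ (j, j + 1) \<noteq> 0" "A $$ (j + d, j + d + 1) \<noteq> 0"
      using super_nz[of j] super_nz[of "j + d"] that by simp_all
    ultimately show ?thesis by (metis mult_eq_0_iff)
  qed
  \<comment> \<open>Linking every entry to the first lets vanishing pass from \<open>m\<close> to
    \<open>i\<close> in either direction.\<close>
  have "Y $$ (j, j + d) = 0 \<longleftrightarrow> Y $$ (0, 0 + d) = 0" if "j + d < n" for j
    using that
  proof (induction j)
    case (Suc j)
    then show ?case using step[of j] by simp
  qed simp
  with m i show ?thesis by metis
qed

text \<open>If rows up to \<open>r\<close> of \<open>Y\<close> vanish, row \<open>r\<close> of
  \<open>Y * A\<close> is zero, while row \<open>r\<close> of \<open>A * Y\<close> is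
  \<open>A $$ (r, r + 1)\<close> times row \<open>r + 1\<close> of \<open>Y\<close>.\<close>

lemma zero_if_first_row_zero:
  assumes "\<And>j. j < n \<Longrightarrow> Y $$ (0, j) = 0"
  shows "Y = 0\<^sub>m n n"
proof -
  have "\<forall>j<n. Y $$ (i, j) = 0" if "i < n" for i
    using that
  proof (induction i rule: less_induct)
    case (less i)
    show ?case
    proof (cases i)
      case 0
      with assms show ?thesis by simp
    next
      case (Suc r)
      have rows: "Y $$ (k, j) = 0" if "k \<le> r" "j < n" for k j
        using less that Suc by simp
      show ?thesis
      proof (intro allI impI)
        fix j assume j: "j < n"
        have "(\<Sum>k<n. A $$ (r, k) * Y $$ (k, j)) = (\<Sum>k\<in>{i}. A $$ (r, k) * Y $$ (k, j))"
        proof (intro sum.mono_neutral_right ballI)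
          fix k assume k: "k \<in> {..<n} - {i}"
          show "A $$ (r, k) * Y $$ (k, j) = 0"
            using k j rows[of k j] hess[of k r] Suc by (cases "k \<le> r") auto
        qed (use less.prems in auto)
        moreover have "(\<Sum>k<n. Y $$ (r, k) * A $$ (k, j)) = 0"
          by (intro sum.neutral) (simp add: rows)
        ultimately have "A $$ (r, i) * Y $$ (i, j) = 0"
          using commute_entry[of r j] j Suc less.prems by simp
        then show "Y $$ (i, j) = 0"
          using super_nz[of r] Suc less.prems by simp
      qed
    qed
  qed
  then show ?thesis using Y by (intro eq_matI) auto
qed

lemma strict_upper_zero:
  assumes "\<And>d. 1 \<le> d \<Longrightarrow> d < n \<Longrightarrow> \<exists>m. m + d < n \<and> Y $$ (m, m + d) = 0"
    and "j < n" "i < j"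
  shows "Y $$ (i, j) = 0"
  using \<open>i < j\<close> \<open>j < n\<close>
\<comment> \<open>The measure shrinks away from the diagonal, so superdiagonals are treated from the
  corner inwards.\<close>
proof (induction "n - (j - i)" arbitrary: i j rule: less_induct)
  case less
  define d where "d = j - i"
  have d: "1 \<le> d" "d < n" "j = i + d" using less.prems by (auto simp: d_def)
  obtain m where m: "m + d < n" "Y $$ (m, m + d) = 0" using assms(1) d by blast
  have "Y $$ (i', j') = 0" if "j' < n" "i' + d < j'" for i' j'
    using less.hyps[of j' i'] that d by simp
  then show ?case
    using superdiagonal_zero[of d m i] m less.prems d by simp
qed

lemma diagonal_constant:
  assumes above: "\<And>i j. j < n \<Longrightarrow> i < j \<Longrightarrow> Y $$ (i, j) = 0" and "i < n"
  shows "Y $$ (i, i) = Y $$ (0, 0)"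
  using \<open>i < n\<close>
proof (induction i)
  case (Suc i)
  then show ?case
    using superdiagonal_step[of 0 i] above super_nz[of i] by simp
qed simp

end

lemma commuting_zero:
  fixes A Y :: "'a :: {idom, ring_char_0} mat"
  assumes "hessenberg_commuting n A Y"
    and diag: "\<And>d. 1 \<le> d \<Longrightarrow> d < n \<Longrightarrow> \<exists>m. m + d < n \<and> Y $$ (m, m + d) = 0"
    and trace: "trace_mat Y = 0"
  shows "Y = 0\<^sub>m n n"
proof -
  interpret hessenberg_commuting n A Y by fact
  note upper = strict_upper_zero[OF diag]
  have "trace_mat Y = (\<Sum>i<n. Y $$ (0, 0))"
    unfolding trace_mat_def
  proof (rule sum.cong)
    fix i assume "i \<in> {..<n}"
    then show "Y $$ (i, i) = Y $$ (0, 0)" by (intro diagonal_constant upper) auto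
  qed (use Y in simp)
  \<comment> \<open>The trace is \<open>n\<close> times this entry, and \<open>n\<close> cancels in
    characteristic zero.\<close>
  then have "Y $$ (0, 0) = 0" if "0 < n" using that trace by simp
  then have "Y $$ (0, j) = 0" if "j < n" for j
    using that upper[of j 0] by (cases "j = 0") auto
  then show ?thesis by (rule zero_if_first_row_zero)
qed

section \<open>From the sign pattern to its real matrices\<close>

lemma has_sign_eq_0_iff: "has_sign x s \<Longrightarrow> x = 0 \<longleftrightarrow> s = Zero"
  by (cases s) auto

theorem theorem3p11:
  fixes n :: nat and S :: "sign mat"
  assumes "proper_hessenberg_pattern n S"
    and "\<And>k. 2 \<le> k \<Longrightarrow> k \<le> n \<Longrightarrow> has_k_cycle (pattern_digraph n S) k"
  shows "requires S (has_nSMP n)"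
  unfolding requires_def has_nSMP_def
proof (intro ballI conjI impI)
  fix A assume "A \<in> qualitative_class S"
  then show A: "A \<in> carrier_mat n n"
    using assms(1) by (auto simp: qualitative_class_def proper_hessenberg_pattern_def)
  have nz: "A $$ (i, j) = 0 \<longleftrightarrow> S $$ (i, j) = Zero" if "i < n" "j < n" for i j
    using \<open>A \<in> qualitative_class S\<close> that assms(1)
    by (intro has_sign_eq_0_iff) (auto simp: qualitative_class_def proper_hessenberg_pattern_def)
  fix X assume X: "X \<in> carrier_mat n n"
    and "A \<circ>\<^sub>m X = 0\<^sub>m n n \<and> A * transpose_mat X - transpose_mat X * A = 0\<^sub>m n n \<and>
      (\<forall>k<n. trace_mat (transpose_mat X * A ^\<^sub>m k) = 0)"
  then have had: "A \<circ>\<^sub>m X = 0\<^sub>m n n"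
    and comm: "A * transpose_mat X - transpose_mat X * A = 0\<^sub>m n n"
    and tr: "\<And>k. k < n \<Longrightarrow> trace_mat (transpose_mat X * A ^\<^sub>m k) = 0" by auto
  define Y where "Y = transpose_mat X"
  have Y: "Y \<in> carrier_mat n n" using X by (simp add: Y_def)
  have "A * Y = Y * A"
  proof (rule eq_matI)
    fix i j assume ij: "i < dim_row (Y * A)" "j < dim_col (Y * A)"
    have "(A * Y - Y * A) $$ (i, j) = (0\<^sub>m n n :: real mat) $$ (i, j)"
      using comm by (simp add: Y_def)
    then show "(A * Y) $$ (i, j) = (Y * A) $$ (i, j)"
      using ij A Y by (simp del: index_mult_mat(1))
  qed (use A Y in auto)
  then have "hessenberg_commuting n A Y"
    using A Y nz assms(1)
    by unfold_locales (auto simp: proper_hessenberg_pattern_def)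
  moreover have "\<exists>m. m + d < n \<and> Y $$ (m, m + d) = 0" if d: "1 \<le> d" "d < n" for d
  proof -
    \<comment> \<open>A cycle on \<open>d + 1\<close> vertices spans \<open>d\<close> index steps,
      and \<open>2 \<le> d + 1 \<le> n\<close>.\<close>
    obtain m where m: "m + d < n" "S $$ (m + d, m) \<noteq> Zero"
      using hessenberg_cycle_entry[OF assms(1) assms(2)[of "d + 1"]] d by auto
    have "(A \<circ>\<^sub>m X) $$ (m + d, m) = 0" using had m by simp
    then have "A $$ (m + d, m) * X $$ (m + d, m) = 0"
      using m A by (simp add: hadamard_mat_def)
    then have "Y $$ (m, m + d) = 0" using m nz[of "m + d" m] X by (simp add: Y_def)
    with m show ?thesis by blast
  qed
  moreover have "trace_mat Y = 0"
  \<comment> \<open>The trace condition for \<open>k = 0\<close> gives the claim when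
    \<open>n > 0\<close>; otherwise the trace is an empty sum.\<close>
  proof (cases "n = 0")
    case True
    with Y show ?thesis by (simp add: trace_mat_def)
  next
    case False
    then show ?thesis using tr[of 0] A Y by (simp add: Y_def)
  qed
  ultimately have "Y = 0\<^sub>m n n" by (rule commuting_zero)
  then have "transpose_mat Y = 0\<^sub>m n n" by simp
  then show "X = 0\<^sub>m n n" by (simp add: Y_def)
qed

end
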